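(* For every $\ell\in(0,1)$ there exists $k=k(\ell)\in\mathbb{N}$ such that for every circular arc $A\subset C$ of length $|A|=\ell$ on the circle $C=\mathbb{R}/\mathbb{Z}$ of unit length, there exist $k$ pairwise distinct constant speeds $v_1,\ldots,v_k>0$ and starting points $\beta_1,\ldots,\beta_k\in C$ with the following property: for $k$ runners moving along $C$ so that runner $i$ is at $f_i(t)=v_i t+\beta_i \bmod 1$ at time $t$, at every time $t\ge 0$ at least one of the $k$ runners is in the complement $C\setminus A$.
   Context: $C=[0,1)\bmod 1=\mathbb{R}/\mathbb{Z}$ is the circle of length $1$. A circular arc of $C$ is the image in $\mathbb{R}/\mathbb{Z}$ of an interval of $\mathbb{R}$ of positive length at most $1$; its length is the length of that interval. All runners run in the same (clockwise) direction, taken as the direction of increasing parameter. A runner with constant speed $v>0$ and starting point $\beta\in C$ is at position $vt+\beta \bmod 1$ at time $t\ge 0$. *)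

theory Defs
  imports "HOL-Analysis.Analysis"
begin

text \<open>
  The circle \<open>\<real>/\<int>\<close> is represented by \<open>[0,1)\<close>; the quotient map is \<^const>\<open>frac\<close>.
\<close>

definition circle :: "real set" where
  "circle = {0..<1}"

text \<open>
  The interval may contain either, both or none of its endpoints.  Boundedness is required because
  \<^const>\<open>Sup\<close> and \<^const>\<open>Inf\<close> on the reals are unspecified on unbounded sets.
\<close>

definition circular_arc_of_length :: "real \<Rightarrow> real set \<Rightarrow> bool" where
  "circular_arc_of_length l A \<longleftrightarrow> 0 < l \<and> l \<le> 1 \<and>
     (\<exists>I. is_interval I \<and> I \<noteq> {} \<and> bounded I \<and> Sup I - Inf I = l \<and> A = frac ` I)"

definition runner_position :: "real \<Rightarrow> real \<Rightarrow> real \<Rightarrow> real" where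
  "runner_position v \<beta> t = frac (v * t + \<beta>)"

end

theory Submission
  imports Defs
begin

text \<open>
  Take the speeds \<open>1, \<dots>, k\<close> and the starting points in a coset of \<open>(1/M)\<int>\<close> with \<open>3/M \<le> 1 - l\<close>.  All
  positions have period 1 in time, and within a time step \<open>1/(k M)\<close> no runner moves farther than
  \<open>1/M\<close>, so it suffices that at each of \<open>k M\<close> sample times some runner lies in a fixed subarc of
  length \<open>1/M\<close> of the complement of the arc.  A given sample time is bad for only \<open>(M - 1)^k\<close> of the
  \<open>M^k\<close> choices of starting points, and \<open>k M (M - 1)^k < M^k\<close> for large \<open>k\<close>.
\<close>

text \<open>After division by \<open>M * M ^ k\<close> this is the limit \<open>k * x ^ k\<close>
  \<rightarrow> 0 for the ratio \<open>x = (M - 1) / M\<close> < 1.\<close>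

lemma ex_times_power_less_power:
  fixes M :: nat
  assumes "M > 0"
  shows "\<exists>k>0. k * M * (M - 1) ^ k < M ^ k"
proof -
  define x where "x = real (M - 1) / real M"
  have "norm x < 1"
    using assms by (simp add: x_def)
  then have "(\<lambda>k. real k * x ^ k) \<longlonglongrightarrow> 0"
    by (rule powser_times_n_limit_0)
  then have "\<forall>\<^sub>F k in sequentially. real k * x ^ k < 1 / real M"
    by (rule order_tendstoD) (use assms in simp)
  then have "\<forall>\<^sub>F k in sequentially. real k * x ^ k < 1 / real M \<and> k > 0"
    using eventually_gt_at_top[of 0] by (rule eventually_conj)
  then obtain k where k: "real k * x ^ k < 1 / real M" "k > 0"
    using eventually_happens'[OF sequentially_bot] by blast
  have "real (k * M * (M - 1) ^ k) < real (M ^ k)"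
    using k assms by (simp add: x_def power_divide field_simps)
  then show ?thesis
    using k(2) of_nat_less_iff by blast
qed

lemma card_avoiding_residue:
  fixes M a :: nat
  assumes "M > 0"
  shows "card {m. m < M \<and> \<not> M dvd a + m} = M - 1"
proof -
  \<comment> \<open>\<open>r\<close> is the residue of -a; the outer \<open>mod M\<close> sends the
    value \<open>M\<close> to 0 when \<open>M\<close> divides \<open>a\<close>.\<close>
  define r where "r = (M - a mod M) mod M"
  have "M dvd a + m \<longleftrightarrow> m = r" if "m < M" for m
  proof -
    have lt: "a mod M < M"
      using assms by simp
    have "M dvd a + m \<longleftrightarrow> (a mod M + m) mod M = 0"
      by (simp add: dvd_eq_mod_eq_0 mod_simps)
    also have "\<dots> \<longleftrightarrow> m = r"
    proof (cases "a mod M + m < M")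
      case True
      then show ?thesis
        using lt that by (cases "a mod M = 0") (auto simp: r_def)
    next
      case False
      then have "a mod M + m - M < M"
        using lt that by linarith
      then have "(a mod M + m) mod M = a mod M + m - M"
        using False le_mod_geq[of M "a mod M + m"] by simp
      moreover have "r = M - a mod M"
        using False that by (cases "a mod M = 0") (auto simp: r_def)
      ultimately show ?thesis
        using False lt by linarith
    qed
    finally show ?thesis .
  qed
  then have "{m. m < M \<and> \<not> M dvd a + m} = {..<M} - {r}"
    by auto
  moreover have "r < M"
    using assms by (simp add: r_def)
  ultimately show ?thesis
    by simp
qed

text \<open>Union bound: sample \<open>j\<close> excludes a set \<open>B j\<close> of
  \<open>(M - 1) ^ card I\<close> shift vectors, one residue being forbidden in each coordinate. The
  \<open>n\<close> sets together are too small to exhaust all \<open>M ^ card I\<close>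
  vectors.\<close>

lemma ex_shifts_hitting:
  fixes c :: "nat \<Rightarrow> nat \<Rightarrow> nat"
  assumes "M > 0" and "finite I" and "n * (M - 1) ^ card I < M ^ card I"
  shows "\<exists>m. \<forall>j<n. \<exists>i\<in>I. M dvd c i j + m i"
proof -
  define B where "B j = PiE I (\<lambda>i. {m. m < M \<and> \<not> M dvd c i j + m})" for j
  have "card (\<Union>j<n. B j) \<le> (\<Sum>j<n. card (B j))"
    by (rule card_UN_le) simp
  also have "\<dots> = n * (M - 1) ^ card I"
    using assms(1,2) by (simp add: B_def card_PiE card_avoiding_residue)
  also have "\<dots> < card (PiE I (\<lambda>_. {..<M}))"
    using assms(2,3) by (simp add: card_PiE)
  finally have "card (\<Union>j<n. B j) < card (PiE I (\<lambda>_. {..<M}))" .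
  moreover have "finite (\<Union>j<n. B j)"
    using assms(2) by (auto simp: B_def intro: finite_PiE)
  ultimately have "\<not> PiE I (\<lambda>_. {..<M}) \<subseteq> (\<Union>j<n. B j)"
    by (meson card_mono leD)
  then obtain m where "m \<in> PiE I (\<lambda>_. {..<M})" "\<And>j. j < n \<Longrightarrow> m \<notin> B j"
    by auto
  then have "\<forall>j<n. \<exists>i\<in>I. M dvd c i j + m i"
    by (fastforce simp: B_def PiE_iff)
  then show ?thesis
    by blast
qed

lemma ex_covering_shifts:
  fixes M :: nat
  assumes "M \<ge> 2"
  shows "\<exists>k. \<exists>m :: nat \<Rightarrow> nat. \<forall>t. \<exists>i\<in>{1..k}. frac (real i * t + real (m i) / real M) < 2 / real M"
proof -
  obtain k where k: "k > 0" "k * M * (M - 1) ^ k < M ^ k"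
    using ex_times_power_less_power[of M] assms by auto
  \<comment> \<open>Sample \<open>j\<close> is the time j/(kM). In units of 1/M the unshifted runner
    \<open>i\<close> is then at i*j/k, rounded down here to an integer.\<close>
  have "\<exists>m. \<forall>j<k * M. \<exists>i\<in>{1..k}. M dvd i * j div k + m i"
    using ex_shifts_hitting[of M "{1..k}" "k * M" "\<lambda>i j. i * j div k"] k assms by simp
  then obtain m where m: "\<And>j. j < k * M \<Longrightarrow> \<exists>i\<in>{1..k}. M dvd i * j div k + m i"
    by blast
  have "\<exists>i\<in>{1..k}. frac (real i * t + real (m i) / real M) < 2 / real M" for t
  proof -
    have M: "real M > 0" and k': "real k > 0"
      using assms k by auto
    \<comment> \<open>Time within one period, measured in sample steps; \<open>j\<close> is the last
      sample not after it.\<close>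
    define s where "s = frac t * real (k * M)"
    define j where "j = nat \<lfloor>s\<rfloor>"
    have "0 \<le> s" "s < real (k * M)"
      using M k' frac_lt_1[of t] by (simp_all add: s_def)
    then have j: "real j \<le> s" "s < real j + 1" "j < k * M"
      unfolding j_def by (auto simp: nat_less_iff floor_less_iff)
    obtain i where i: "i \<in> {1..k}" "M dvd i * j div k + m i"
      using m[OF j(3)] by blast
    then obtain p where p: "i * j div k + m i = M * p"
      by blast
    define q where "q = i * j div k"
    have "q * k \<le> i * j" "i * j < (q + 1) * k"
      unfolding q_def using k(1) dividend_less_div_times[of k "i * j"]
      by (auto simp: algebra_simps)
    then have "real (q * k) \<le> real (i * j)" "real (i * j) < real ((q + 1) * k)"
      by (simp_all only: of_nat_le_iff of_nat_less_iff)
    then have q: "real q * real k \<le> real i * real j" "real i * real j < (real q + 1) * real k"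
      by (simp_all add: algebra_simps)
    have "real i * real j \<le> real i * s" "real i * s \<le> real i * (real j + 1)" "real i \<le> real k"
      using j i by (auto intro: mult_left_mono)
    \<comment> \<open>The 2 allows one unit for the rounding in \<open>q\<close> and one for the
      motion since sample \<open>j\<close>, which is at most i/k \<le> 1.\<close>
    then have "real q * real k \<le> real i * s" "real i * s < (real q + 2) * real k"
      using q by (auto simp: algebra_simps)
    then have "real q \<le> real i * s / real k" "real i * s / real k < real q + 2"
      using k' by (simp_all add: field_simps)
    moreover have "real i * s / real k = real i * frac t * real M"
      using k' by (simp add: s_def)
    moreover have "real q + real (m i) = real M * real p"
      using p unfolding q_def by (metis of_nat_add of_nat_mult)
    ultimately have bounds: "real M * real p \<le> real i * frac t * real M + real (m i)"
        "real i * frac t * real M + real (m i) < real M * real p + 2"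
      by linarith+
    define y where "y = real i * frac t + real (m i) / real M - real p"
    have "real M * y = real i * frac t * real M + real (m i) - real M * real p"
      using M by (simp add: y_def field_simps)
    then have "0 \<le> real M * y" "real M * y < 2"
      using bounds by linarith+
    then have y: "0 \<le> y" "y < 2 / real M"
      using M by (simp_all add: zero_le_mult_iff pos_less_divide_eq mult.commute)
    have "2 / real M \<le> 1"
      using assms by simp
    then have "y < 1"
      using y(2) by linarith
    \<comment> \<open>As the speed is an integer, replacing \<open>t\<close> by
      \<open>frac t\<close> drops only whole turns.\<close>
    have "real i * t + real (m i) / real M = y + of_int (int i * \<lfloor>t\<rfloor> + int p)"
      by (simp add: y_def frac_def algebra_simps)
    then have "frac (real i * t + real (m i) / real M) = frac y"
      by (simp only: frac_add_of_int_right)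
    also have "frac y = y"
      using y(1) \<open>y < 1\<close> by (simp add: frac_eq)
    finally show ?thesis
      using y(2) i(1) by auto
  qed
  then show ?thesis
    by blast
qed

text \<open>With \<open>b\<close> the right end \<open>Sup I\<close>, points of the arc lie at
  offset 0 or at least 1 - \<open>l\<close> from \<open>b\<close>. The strict bounds describe the
  open gap behind the arc, whichever endpoints \<open>I\<close> contains.\<close>

lemma circular_arc_avoids:
  assumes "circular_arc_of_length l A"
  obtains b where "\<And>x. 0 < frac (x - b) \<Longrightarrow> frac (x - b) < 1 - l \<Longrightarrow> frac x \<notin> A"
proof -
  obtain I where I: "bounded I" "Sup I - Inf I = l" "A = frac ` I"
    using assms by (auto simp: circular_arc_of_length_def)
  have "frac x \<notin> A" if x: "0 < frac (x - Sup I)" "frac (x - Sup I) < 1 - l" for x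
  proof
    assume "frac x \<in> A"
    then obtain y where y: "y \<in> I" "frac x = frac y"
      using I(3) by auto
    have "y \<le> Sup I" "Inf I \<le> y"
      using y I(1) by (auto intro: cSup_upper cInf_lower bounded_imp_bdd_above bounded_imp_bdd_below)
    then have yb: "- l \<le> y - Sup I" "y - Sup I \<le> 0"
      using I(2) by auto
    have "x - Sup I = (y - Sup I) + of_int (\<lfloor>x\<rfloor> - \<lfloor>y\<rfloor>)"
      using y(2) by (simp add: frac_def)
    then have eq: "frac (x - Sup I) = frac (y - Sup I)"
      by (simp only: frac_add_of_int_right)
    then have "y - Sup I \<noteq> 0"
      using x(1) by auto
    then have "\<lfloor>y - Sup I\<rfloor> \<le> -1"
      using yb by (simp add: floor_le_iff)
    then have "frac (y - Sup I) \<ge> y - Sup I + 1"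
      unfolding frac_def by linarith
    then show False
      using eq x(2) yb by linarith
  qed
  then show thesis
    using that by blast
qed

theorem theorem1:
  fixes l :: real
  assumes "0 < l" and "l < 1"
  shows "\<exists>k::nat. \<forall>A. circular_arc_of_length l A \<longrightarrow>
           (\<exists>v \<beta> :: nat \<Rightarrow> real.
              inj_on v {1..k} \<and> (\<forall>i\<in>{1..k}. 0 < v i \<and> \<beta> i \<in> circle) \<and>
              (\<forall>t\<ge>0. \<exists>i\<in>{1..k}. runner_position (v i) (\<beta> i) t \<in> circle - A))"
proof -
  \<comment> \<open>The gap must hold a window of length 2/M preceded by a margin of 1/M. Since
    \<open>M\<close>, and then \<open>k\<close> and \<open>m\<close>, depend on \<open>l\<close>
    alone, \<open>k\<close> is fixed before the arc.\<close>
  define M where "M = nat \<lceil>3 / (1 - l)\<rceil>"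
  have *: "3 / (1 - l) \<le> real M"
    unfolding M_def by linarith
  moreover have "3 < 3 / (1 - l)"
    using assms by (simp add: field_simps)
  ultimately have "3 < real M"
    by linarith
  moreover have "3 \<le> (1 - l) * real M"
    using * assms by (simp add: field_simps)
  ultimately have M: "M \<ge> 2" "3 / real M \<le> 1 - l"
    by (simp_all add: pos_divide_le_eq)
  obtain k and m :: "nat \<Rightarrow> nat" where
    m: "\<And>t. \<exists>i\<in>{1..k}. frac (real i * t + real (m i) / real M) < 2 / real M"
    using ex_covering_shifts[OF M(1)] by blast
  show ?thesis
  proof (rule exI[of _ k], intro allI impI)
    fix A
    assume "circular_arc_of_length l A"
    then obtain b where b: "\<And>x. 0 < frac (x - b) \<Longrightarrow> frac (x - b) < 1 - l \<Longrightarrow> frac x \<notin> A"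
      by (rule circular_arc_avoids) blast
    \<comment> \<open>A common rotation moves the window to the offsets from 1/M to 3/M past
      \<open>b\<close>; the extra 1/M keeps it off the endpoint \<open>b\<close>.\<close>
    define \<beta> where "\<beta> i = frac (real (m i) / real M + b + 1 / real M)" for i
    have "\<exists>i\<in>{1..k}. runner_position (real i) (\<beta> i) t \<in> circle - A" for t
    proof -
      obtain i where i: "i \<in> {1..k}" "frac (real i * t + real (m i) / real M) < 2 / real M"
        using m by blast
      define u where "u = real i * t + real (m i) / real M"
      define x where "x = real i * t + \<beta> i"
      have "x - b = frac u + 1 / real M
          + of_int (\<lfloor>u\<rfloor> - \<lfloor>real (m i) / real M + b + 1 / real M\<rfloor>)"
        by (simp add: x_def \<beta>_def u_def frac_def)
      then have "frac (x - b) = frac (frac u + 1 / real M)"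
        by (simp only: frac_add_of_int_right)
      \<comment> \<open>No wraparound: the sum is below 3/M \<le> 1 - \<open>l\<close> < 1.\<close>
      also have "\<dots> = frac u + 1 / real M"
        using i(2) M assms unfolding u_def[symmetric] by (subst frac_eq) auto
      finally have "0 < frac (x - b)" "frac (x - b) < 1 - l"
        using i(2) M unfolding u_def[symmetric] by (auto intro: add_nonneg_pos)
      then have "frac x \<notin> A"
        by (rule b)
      then show ?thesis
        using i(1) by (auto simp: runner_position_def circle_def x_def frac_lt_1)
    qed
    moreover have "inj_on real {1..k}" "\<forall>i\<in>{1..k}. 0 < real i \<and> \<beta> i \<in> circle"
      by (auto simp: inj_on_def \<beta>_def circle_def frac_lt_1)
    ultimately show "\<exists>v \<beta>. inj_on v {1..k} \<and> (\<forall>i\<in>{1..k}. 0 < v i \<and> \<beta> i \<in> circle) \<and>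
        (\<forall>t\<ge>0. \<exists>i\<in>{1..k}. runner_position (v i) (\<beta> i) t \<in> circle - A)"
      by blast
  qed
qed

end
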